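(* For all sufficiently large integers $d$, $\mathrm{VC}(\mathcal{B}^d_{\mathrm{per}}) \leq d\bigl(\log_2(d) + 3 \log_2(\log_2(d))\bigr)$.
   Context: For a family $H$ of sets and a set $C$, let $H\cap C=\{h\cap C: h\in H\}$; $H$ shatters $C$ if $|H\cap C|=2^{|C|}$. The VC-dimension $\mathrm{VC}(H)$ is the largest integer $D$ such that some set $C$ of cardinality $D$ is shattered by $H$. The torus $\mathbb{T}$ is $[0,1]$ with $0$ and $1$ identified. For $a<b$ the interval $[a,b]$ is the usual one; for $a>b$, $[a,b]:=[0,b]\cup[a,1]$. $\mathcal{B}^d_{\mathrm{per}}=\{[a_1,b_1]\times\cdots\times[a_d,b_d] : 0\le a_i\ne b_i\le 1 \text{ for all } i\}$ is the set of axis-parallel boxes in the torus $\mathbb{T}^d$. *)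

theory Defs
  imports "HOL-Library.Extended_Real" "HOL-Library.FuncSet" Complex_Main
begin

definition trace_on :: "'a set set \<Rightarrow> 'a set \<Rightarrow> 'a set set" where
  "trace_on H C = (\<lambda>h. h \<inter> C) ` H"

text \<open>Finiteness is required because \<open>card\<close> is \<open>0\<close> on infinite sets.\<close>

definition shatters :: "'a set set \<Rightarrow> 'a set \<Rightarrow> bool" where
  "shatters H C \<longleftrightarrow> finite C \<and> card (trace_on H C) = 2 ^ card C"

text \<open>The supremum is taken in the extended naturals: it is the largest cardinality of a
  shattered set if there is one, and \<open>\<infinity>\<close> if shattered sets can be arbitrarily large.
  In particular, a finite upper bound on it includes the existence of the maximum.\<close>

definition VC :: "'a set set \<Rightarrow> enat" where
  "VC H = (SUP C \<in> {C. shatters H C}. enat (card C))"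

definition torus_rel :: "real \<Rightarrow> real \<Rightarrow> bool" where
  "torus_rel x y \<longleftrightarrow> x \<in> {0..1} \<and> y \<in> {0..1} \<and> (x = y \<or> {x, y} = {0, 1})"

quotient_type torus = real / partial: torus_rel
  morphisms rep_torus torus_of
proof (rule part_equivpI)
  show "\<exists>x. torus_rel x x"
    by (rule exI[of _ 0]) (simp add: torus_rel_def)
  show "symp torus_rel"
    by (auto simp: symp_def torus_rel_def)
  show "transp torus_rel"
    by (auto simp: transp_def torus_rel_def doubleton_eq_iff)
qed

text \<open>The interval is a subset of \<open>[0,1]\<close> pushed to the quotient, so \<open>[a,1]\<close> also
  contains the class of \<open>0\<close>. It is used only for \<open>a \<noteq> b\<close>.\<close>

definition torus_interval :: "real \<Rightarrow> real \<Rightarrow> torus set" where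
  "torus_interval a b = torus_of ` (if a < b then {a..b} else {0..b} \<union> {a..1})"

text \<open>Points of the \<open>d\<close>-dimensional torus are the functions in \<open>{..<d} \<rightarrow>\<^sub>E UNIV\<close>.\<close>

definition B_per :: "nat \<Rightarrow> (nat \<Rightarrow> torus) set set" where
  "B_per d = {Pi\<^sub>E {..<d} (\<lambda>i. torus_interval (a i) (b i)) | a b.
     \<forall>i<d. a i \<in> {0..1} \<and> b i \<in> {0..1} \<and> a i \<noteq> b i}"

end

theory Submission
  imports Defs "HOL-Real_Asymp.Real_Asymp"
begin

text \<open>The complement of a box trace on an \<open>n\<close>-point set \<open>C\<close> is a union of \<open>d\<close> cyclic arcs of \<open>C\<close>,
  one per coordinate. Bounding the number of arcs in each coordinate by \<open>n\<^sup>2\<close> would lose a factor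
  of 2. But each coordinate has at most \<open>n + 1\<close> arcs of any given size, so an arc of size at least
  \<open>L \<approx> log 2 (4 d n)\<close> is disjoint from at most half of all subsets of \<open>C\<close>; the remaining
  subsets only use arcs of size below \<open>L\<close>, of which there are at most \<open>(n + 1) L\<close> per coordinate.
  Hence \<open>2 ^ n \<le> 2 ((n + 1) L) ^ d\<close>.\<close>

section \<open>Cyclic arcs cut out by a chain of sets\<close>

text \<open>For a chain \<D> of initial segments of \<open>C\<close>, the differences are the arcs
  that stay within the linear order and the unions are those that wrap around its end. Using sets
  instead of endpoints lets several points share a coordinate.\<close>

definition arcs :: "'a set \<Rightarrow> 'a set set \<Rightarrow> 'a set set" where
  "arcs C \<D> = {E - D | D E. D \<in> \<D> \<and> E \<in> \<D> \<and> D \<subseteq> E} \<union>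
     {E \<union> (C - D) | D E. D \<in> \<D> \<and> E \<in> \<D> \<and> E \<subseteq> D}"

lemma arcs_diffI: "D \<in> \<D> \<Longrightarrow> E \<in> \<D> \<Longrightarrow> D \<subseteq> E \<Longrightarrow> E - D \<in> arcs C \<D>"
  by (auto simp: arcs_def)

lemma arcs_unionI: "D \<in> \<D> \<Longrightarrow> E \<in> \<D> \<Longrightarrow> E \<subseteq> D \<Longrightarrow> E \<union> (C - D) \<in> arcs C \<D>"
  by (auto simp: arcs_def)

lemma arcs_subset: "\<D> \<subseteq> Pow C \<Longrightarrow> arcs C \<D> \<subseteq> Pow C"
  by (auto simp: arcs_def)

text \<open>An arc of size \<open>l\<close> is determined by the number \<open>s\<close> of points preceding its start, because
  members of a chain are determined by their cardinality.\<close>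

lemma card_arcs_of_size_le:
  assumes fin: "finite C" and sub: "\<D> \<subseteq> Pow C" and top: "C \<in> \<D>"
    and chain: "\<And>D E. D \<in> \<D> \<Longrightarrow> E \<in> \<D> \<Longrightarrow> D \<subseteq> E \<or> E \<subseteq> D"
  shows "card {G \<in> arcs C \<D>. card G = l} \<le> card C + 1"
proof -
  define n where "n = card C"
  have finD: "finite D" if "D \<in> \<D>" for D
    using that sub fin by (meson PowD finite_subset subsetD)
  have cardD: "card D \<le> n" if "D \<in> \<D>" for D
    using that sub fin unfolding n_def by (meson PowD card_mono subsetD)
  have inj: "inj_on card \<D>"
    by (rule inj_onI) (metis chain finD card_subset_eq)
  define dn where "dn = inv_into \<D> card"
  have dn: "dn (card D) = D" if "D \<in> \<D>" for D
    using that inj by (simp add: dn_def)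
  \<comment> \<open>If \<open>s + l\<close> exceeds \<open>n\<close>, the arc passes the end of the
    order and its last \<open>s + l - n\<close> points form an initial segment.\<close>
  define h where "h s = (if s + l \<le> n then dn (s + l) - dn s else dn (s + l - n) \<union> (C - dn s))" for s
  have "{G \<in> arcs C \<D>. card G = l} \<subseteq> h ` {..n}"
  proof
    fix G assume "G \<in> {G \<in> arcs C \<D>. card G = l}"
    then have G: "G \<in> arcs C \<D>" and l: "card G = l" by auto
    from G consider
      (diff) D E where "D \<in> \<D>" "E \<in> \<D>" "D \<subseteq> E" "G = E - D" |
      (union) D E where "D \<in> \<D>" "E \<in> \<D>" "E \<subseteq> D" "G = E \<union> (C - D)"
      unfolding arcs_def by blast
    then show "G \<in> h ` {..n}"
    proof cases
      case diff
      have "card D + l = card E"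
        using diff l finD card_Diff_subset[of D E] card_mono[of E D] by simp
      then have "h (card D) = G"
        using diff dn cardD[of E] by (simp add: h_def)
      then show ?thesis using cardD[OF diff(1)] by blast
    next
      case union
      have DC: "D \<subseteq> C" using union sub by auto
      have "card G = card E + card (C - D)"
        unfolding union(4) using union fin finD by (intro card_Un_disjoint) auto
      moreover have "card (C - D) = n - card D"
        unfolding n_def using DC finD[OF union(1)] by (simp add: card_Diff_subset)
      ultimately have eq: "card D + l = n + card E"
        using l cardD[OF union(1)] by simp
      have "h (card D) = G"
      \<comment> \<open>With \<open>E\<close> empty, \<open>card D + l\<close> is exactly
        \<open>n\<close>, so \<open>h\<close> takes its non-wrapping branch; it still returns
        \<open>C - D\<close> because \<open>C\<close> is the chain member of size
        \<open>n\<close>.\<close>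
      proof (cases "card E = 0")
        case True
        then have "E = {}" using finD[OF union(2)] by simp
        then show ?thesis using eq union dn dn[OF top] by (simp add: h_def n_def)
      next
        case False
        then show ?thesis using eq union dn by (simp add: h_def)
      qed
      then show ?thesis using cardD[OF union(1)] by blast
    qed
  qed
  then have "card {G \<in> arcs C \<D>. card G = l} \<le> card {..n}"
    by (rule surj_card_le[rotated]) simp
  then show ?thesis by (simp add: n_def)
qed

section \<open>Torus coordinates and complements of intervals\<close>

text \<open>The chosen representative of the glued point may be 0 or 1; sending it to 0 gives each
  class a unique coordinate in \<open>[0,1)\<close>.\<close>

definition torus_coord :: "torus \<Rightarrow> real" where
  "torus_coord t = (if rep_torus t = 1 then 0 else rep_torus t)"

lemma torus_coord_bounds: "0 \<le> torus_coord t" "torus_coord t < 1"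
proof -
  have "torus_rel (rep_torus t) (rep_torus t)"
    by (rule Quotient_rep_reflp[OF Quotient_torus])
  then have "rep_torus t \<in> {0..1}" by (simp add: torus_rel_def)
  then show "0 \<le> torus_coord t" "torus_coord t < 1"
    by (auto simp: torus_coord_def)
qed

lemma torus_of_eq_iff:
  assumes "x \<in> {0..1}" "y \<in> {0..1}"
  shows "torus_of x = torus_of y \<longleftrightarrow> torus_rel x y"
  using Quotient_rel[OF Quotient_torus, of x y] assms by (auto simp: torus_rel_def)

lemma torus_of_coord: "torus_of (torus_coord t) = t"
proof -
  have "torus_of (rep_torus t) = t"
    by (rule Quotient_abs_rep[OF Quotient_torus])
  moreover have "torus_of 0 = torus_of 1"
    by (subst torus_of_eq_iff) (auto simp: torus_rel_def)
  ultimately show ?thesis by (auto simp: torus_coord_def)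
qed

text \<open>Gluing matters only for the endpoint 1, whose class has coordinate 0. A wrapping
  interval contains 0 anyway, so the extra disjunct occurs only for \<open>a < b\<close>.\<close>

lemma mem_torus_interval_iff:
  assumes "a \<in> {0..1}" "b \<in> {0..1}" "a \<noteq> b"
  shows "t \<in> torus_interval a b \<longleftrightarrow>
    (if a < b then a \<le> torus_coord t \<and> torus_coord t \<le> b \<or> b = 1 \<and> torus_coord t = 0
     else torus_coord t \<le> b \<or> a \<le> torus_coord t)"
proof -
  define x where "x = torus_coord t"
  have x: "0 \<le> x" "x < 1" using torus_coord_bounds by (auto simp: x_def)
  define I where "I = (if a < b then {a..b} else {0..b} \<union> {a..1})"
  have I: "I \<subseteq> {0..1}" using assms by (auto simp: I_def)
  have "t \<in> torus_interval a b \<longleftrightarrow> (\<exists>y\<in>I. torus_of x = torus_of y)"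
    unfolding torus_interval_def I_def[symmetric] x_def torus_of_coord by auto
  also have "\<dots> \<longleftrightarrow> (\<exists>y\<in>I. torus_rel x y)"
    using I x by (intro bex_cong refl torus_of_eq_iff) auto
  also have "\<dots> \<longleftrightarrow> x \<in> I \<or> x = 0 \<and> 1 \<in> I"
  proof
    assume "\<exists>y\<in>I. torus_rel x y"
    then show "x \<in> I \<or> x = 0 \<and> 1 \<in> I"
      using x by (auto simp: torus_rel_def doubleton_eq_iff)
  next
    assume "x \<in> I \<or> x = 0 \<and> 1 \<in> I"
    moreover have "torus_rel x x" "torus_rel 0 1" using x by (auto simp: torus_rel_def)
    ultimately show "\<exists>y\<in>I. torus_rel x y" by blast
  qed
  finally show ?thesis
    using assms x unfolding x_def[symmetric] I_def by (auto split: if_splits)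
qed

text \<open>Both strict and non-strict cuts appear because the complement of a closed interval is an
  open arc.\<close>

definition initial_segments :: "('a \<Rightarrow> real) \<Rightarrow> 'a set \<Rightarrow> 'a set set" where
  "initial_segments g C =
     range (\<lambda>b. {c \<in> C. g c \<le> b}) \<union> range (\<lambda>a. {c \<in> C. g c < a}) \<union> {{}, C}"

text \<open>Members are downward closed in \<open>C\<close> for the total preorder induced by
  \<open>g\<close>, and two such sets are always comparable.\<close>

lemma initial_segments_chain:
  assumes "D \<in> initial_segments g C" "E \<in> initial_segments g C"
  shows "D \<subseteq> E \<or> E \<subseteq> D"
proof -
  have downclosed: "D \<subseteq> C \<and> (\<forall>x\<in>D. \<forall>y\<in>C. g y \<le> g x \<longrightarrow> y \<in> D)"
    if "D \<in> initial_segments g C" for D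
    using that by (fastforce simp: initial_segments_def)
  show ?thesis
    using downclosed[OF assms(1)] downclosed[OF assms(2)] by (meson linear subset_iff)
qed

lemma torus_interval_compl_in_arcs:
  assumes "a \<in> {0..1}" "b \<in> {0..1}" "a \<noteq> b"
  shows "{c \<in> C. f c \<notin> torus_interval a b} \<in> arcs C (initial_segments (torus_coord \<circ> f) C)"
    (is "?G \<in> arcs C ?\<D>")
proof -
  define g where "g = torus_coord \<circ> f"
  have g: "0 \<le> g c" "g c < 1" for c using torus_coord_bounds by (auto simp: g_def)
  have G: "?G = {c \<in> C. \<not> (if a < b then a \<le> g c \<and> g c \<le> b \<or> b = 1 \<and> g c = 0
     else g c \<le> b \<or> a \<le> g c)}"
    using mem_torus_interval_iff[OF assms] by (simp add: g_def)
  have le: "{c \<in> C. g c \<le> u} \<in> ?\<D>" and less: "{c \<in> C. g c < u} \<in> ?\<D>" for u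
    by (auto simp: initial_segments_def g_def)
  \<comment> \<open>An interval ending at 1 also contains the point of coordinate 0, so its
    complement starts strictly after 0, or is empty if \<open>a = 0\<close>.\<close>
  consider (wrap) "b < a" | (one) "a < b" "b = 1" "0 < a" | (full) "b = 1" "a = 0" | (mid) "a < b" "b < 1"
    using assms by fastforce
  then show ?thesis
  proof cases
    case wrap
    have "?G = {c \<in> C. g c < a} - {c \<in> C. g c \<le> b}" unfolding G using wrap by auto
    also have "\<dots> \<in> arcs C ?\<D>" using le less wrap by (intro arcs_diffI) auto
    finally show ?thesis .
  next
    case one
    have "g c \<le> 1" for c using g(2)[of c] by simp
    then have "?G = {c \<in> C. g c < a} - {c \<in> C. g c \<le> 0}"
      unfolding G using one g(1) by (auto simp: not_le order_less_le intro: antisym)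
    also have "\<dots> \<in> arcs C ?\<D>" using le less one by (intro arcs_diffI) auto
    finally show ?thesis .
  next
    case full
    have "?G = {} - {}" unfolding G using full g by (auto simp: order_less_le)
    also have "\<dots> \<in> arcs C ?\<D>" by (intro arcs_diffI) (auto simp: initial_segments_def)
    finally show ?thesis .
  next
    case mid
    have "?G = {c \<in> C. g c < a} \<union> (C - {c \<in> C. g c \<le> b})" unfolding G using mid by auto
    also have "\<dots> \<in> arcs C ?\<D>" using le less mid by (intro arcs_unionI) auto
    finally show ?thesis .
  qed
qed

section \<open>Counting subsets that avoid long or short sets\<close>

text \<open>Union bound: a set of size \<open>l\<close> is avoided by a fraction
  \<open>1 / 2 ^ l\<close> of all subsets. With at most \<open>N\<close> sets of each size, the
  geometric series from \<open>L\<close> on contributes the factor 2.\<close>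

lemma card_subsets_avoiding_le:
  assumes fin: "finite C" and sub: "\<F> \<subseteq> Pow C"
    and few: "\<And>l. card {G \<in> \<F>. card G = l} \<le> N"
  shows "real (card {S \<in> Pow C. \<exists>G\<in>\<F>. L \<le> card G \<and> S \<inter> G = {}}) \<le> 2 * real N * 2 ^ card C / 2 ^ L"
proof -
  define n where "n = card C"
  define \<G> where "\<G> = {G \<in> \<F>. L \<le> card G}"
  have finF: "finite \<F>" using sub fin by (meson finite_Pow_iff finite_subset)
  have finG: "finite \<G>" using finF by (simp add: \<G>_def)
  have cardG: "card G \<le> n" if "G \<in> \<F>" for G
    using that sub fin unfolding n_def by (meson PowD card_mono subsetD)
  have "card {S \<in> Pow C. \<exists>G\<in>\<F>. L \<le> card G \<and> S \<inter> G = {}} \<le> card (\<Union>G\<in>\<G>. Pow (C - G))"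
    using finG fin by (intro card_mono) (auto simp: \<G>_def)
  also have "\<dots> \<le> (\<Sum>G\<in>\<G>. card (Pow (C - G)))"
    by (rule card_UN_le[OF finG])
  finally have "real (card {S \<in> Pow C. \<exists>G\<in>\<F>. L \<le> card G \<and> S \<inter> G = {}})
      \<le> real (\<Sum>G\<in>\<G>. card (Pow (C - G)))"
    by (rule of_nat_mono)
  also have "\<dots> = (\<Sum>G\<in>\<G>. 2 ^ n / 2 ^ card G)"
  proof -
    have "real (card (Pow (C - G))) = 2 ^ n / 2 ^ card G" if "G \<in> \<G>" for G
    proof -
      have "G \<in> \<F>" using that by (simp add: \<G>_def)
      moreover from this have "G \<subseteq> C" "finite G" using sub fin finite_subset[of G C] by auto
      ultimately have "card (Pow (C - G)) = 2 ^ (n - card G)" and "card G \<le> n"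
        using cardG fin by (auto simp: card_Pow card_Diff_subset n_def)
      then show ?thesis by (simp only: of_nat_power of_nat_numeral) (simp add: power_diff)
    qed
    then show ?thesis by simp
  qed
  also have "\<dots> = (\<Sum>l\<in>{L..n}. \<Sum>G\<in>{G \<in> \<G>. card G = l}. 2 ^ n / 2 ^ card G)"
    by (rule sum.group[symmetric]) (use finG cardG in \<open>auto simp: \<G>_def\<close>)
  also have "\<dots> \<le> (\<Sum>l\<in>{L..n}. real N * (2 ^ n / 2 ^ l))"
  proof (rule sum_mono)
    fix l
    have "card {G \<in> \<G>. card G = l} \<le> N"
      by (rule order_trans[OF card_mono few[of l]]) (use finF in \<open>auto simp: \<G>_def\<close>)
    then show "(\<Sum>G\<in>{G \<in> \<G>. card G = l}. 2 ^ n / 2 ^ card G) \<le> real N * (2 ^ n / 2 ^ l)"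
      by (simp add: mult_right_mono divide_right_mono)
  qed
  also have "\<dots> = real N * 2 ^ n * (\<Sum>l=L..n. (1 / 2) ^ l)"
    by (simp add: sum_distrib_left power_one_over field_simps)
  also have "\<dots> \<le> real N * 2 ^ n * (2 / 2 ^ L)"
  proof (rule mult_left_mono)
    have "(\<Sum>l=L..n. (1 / 2 :: real) ^ l) \<le> 2 * (1 / 2) ^ L"
      by (subst sum_gp) simp
    then show "(\<Sum>l=L..n. (1 / 2 :: real) ^ l) \<le> 2 / 2 ^ L"
      by (simp add: power_one_over)
  qed simp
  finally show ?thesis by (simp add: n_def mult_ac)
qed

text \<open>The choice of \<open>L\<close> makes the \<open>d\<close> union bounds add up to at most
  half of \<open>Pow C\<close>. Each remaining subset is determined by a \<open>d\<close>-tuple of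
  sets of size below \<open>L\<close>, with at most \<open>N\<close> choices for each of the
  \<open>L\<close> sizes.\<close>

lemma two_power_card_le:
  fixes \<F> :: "nat \<Rightarrow> 'a set set"
  assumes fin: "finite C" and sub: "\<And>i. i < d \<Longrightarrow> \<F> i \<subseteq> Pow C"
    and few: "\<And>i l. i < d \<Longrightarrow> card {G \<in> \<F> i. card G = l} \<le> N"
    and repr: "\<And>S. S \<subseteq> C \<Longrightarrow> \<exists>G. (\<forall>i<d. G i \<in> \<F> i) \<and> S = C - (\<Union>i<d. G i)"
    and L: "4 * d * N \<le> 2 ^ L"
  shows "2 ^ card C \<le> 2 * (N * L) ^ d"
proof -
  define bad where "bad i = {S \<in> Pow C. \<exists>G\<in>\<F> i. L \<le> card G \<and> S \<inter> G = {}}" for i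
  define short where "short i = {G \<in> \<F> i. card G < L}" for i
  have finF: "finite (\<F> i)" if "i < d" for i
    using sub[OF that] fin by (meson finite_Pow_iff finite_subset)
  have "real (card (\<Union>i<d. bad i)) \<le> (\<Sum>i<d. real (card (bad i)))"
    using card_UN_le[of "{..<d}" bad] by (metis finite_lessThan of_nat_mono of_nat_sum)
  also have "\<dots> \<le> (\<Sum>i<d. 2 * real N * 2 ^ card C / 2 ^ L)"
    using card_subsets_avoiding_le[OF fin sub few] by (intro sum_mono) (simp add: bad_def)
  also have "\<dots> = real (4 * d * N) / 2 ^ L * 2 ^ card C / 2"
    by simp
  also have "\<dots> \<le> 1 * 2 ^ card C / 2"
  proof -
    have "real (4 * d * N) \<le> 2 ^ L" using of_nat_mono[OF L, where 'a = real] by simp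
    then show ?thesis by (intro divide_right_mono mult_right_mono) (simp_all add: divide_le_eq)
  qed
  finally have bad: "2 * card (\<Union>i<d. bad i) \<le> 2 ^ card C"
    by (simp flip: of_nat_le_iff[where 'a = real])
  have "Pow C - (\<Union>i<d. bad i) \<subseteq> (\<lambda>G. C - (\<Union>i<d. G i)) ` Pi\<^sub>E {..<d} short"
  proof
    fix S assume S: "S \<in> Pow C - (\<Union>i<d. bad i)"
    then obtain G where G: "\<forall>i<d. G i \<in> \<F> i" "S = C - (\<Union>i<d. G i)"
      using repr[of S] by auto
    have "G i \<in> short i" if "i < d" for i
    proof -
      have "S \<inter> G i = {}" using G(2) that by auto
      then have "\<not> L \<le> card (G i)" using S that G(1) by (auto simp: bad_def)
      then show ?thesis using G(1) that by (simp add: short_def)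
    qed
    \<comment> \<open>Values of \<open>G\<close> outside \<open>{..<d}\<close> are arbitrary;
      restricting them puts the tuple into a finite product.\<close>
    then have "restrict G {..<d} \<in> Pi\<^sub>E {..<d} short" by auto
    moreover have "S = C - (\<Union>i<d. restrict G {..<d} i)" using G(2) by simp
    ultimately show "S \<in> (\<lambda>G. C - (\<Union>i<d. G i)) ` Pi\<^sub>E {..<d} short" by blast
  qed
  then have "card (Pow C - (\<Union>i<d. bad i)) \<le> card (Pi\<^sub>E {..<d} short)"
    by (rule surj_card_le[rotated]) (auto intro!: finite_PiE simp: short_def finF)
  also have "\<dots> = (\<Prod>i<d. card (short i))"
    by (simp add: card_PiE)
  also have "\<dots> \<le> (\<Prod>i<d. N * L)"
  proof (rule prod_mono, intro conjI)
    fix i assume "i \<in> {..<d}"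
    then have i: "i < d" by simp
    have "card (short i) \<le> card (\<Union>l<L. {G \<in> \<F> i. card G = l})"
      using finF[OF i] by (intro card_mono) (auto simp: short_def)
    also have "\<dots> \<le> (\<Sum>l<L. card {G \<in> \<F> i. card G = l})"
      by (rule card_UN_le) simp
    also have "\<dots> \<le> (\<Sum>l<L. N)" by (rule sum_mono) (rule few[OF i])
    finally show "card (short i) \<le> N * L" by (simp add: mult.commute)
  qed simp
  finally have good: "card (Pow C - (\<Union>i<d. bad i)) \<le> (N * L) ^ d" by simp
  have "card (Pow C) = card (Pow C - (\<Union>i<d. bad i)) + card (\<Union>i<d. bad i)"
  proof -
    have "(\<Union>i<d. bad i) \<subseteq> Pow C" by (auto simp: bad_def)
    then show ?thesis
      using fin by (metis card_Diff_subset card_mono finite_Pow_iff finite_subset le_add_diff_inverse2)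
  qed
  then show ?thesis using good bad fin by (simp add: card_Pow)
qed

section \<open>Shattering, and the bound for torus boxes\<close>

text \<open>The trace is a subfamily of the finite set \<open>Pow C\<close> with the same
  cardinality, hence all of it.\<close>

lemma shatters_imp_trace:
  assumes "shatters H C" "S \<subseteq> C"
  shows "\<exists>h\<in>H. h \<inter> C = S"
proof -
  have fin: "finite C" and card: "card (trace_on H C) = card (Pow C)"
    using assms by (auto simp: shatters_def card_Pow)
  have "trace_on H C \<subseteq> Pow C" by (auto simp: trace_on_def)
  then have "trace_on H C = Pow C" using card fin by (intro card_subset_eq) auto
  then have "S \<in> (\<lambda>h. h \<inter> C) ` H" using assms(2) by (simp add: trace_on_def)
  then show ?thesis by blast
qed

text \<open>This allows a shattered set to be shrunk to a prescribed size, as required when the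
  bound itself depends on the size.\<close>

lemma shatters_subset:
  assumes "shatters H C" "D \<subseteq> C"
  shows "shatters H D"
proof -
  have fin: "finite D" using assms finite_subset by (auto simp: shatters_def)
  have "trace_on H D = Pow D"
  proof
    show "Pow D \<subseteq> trace_on H D"
    proof
      fix S assume "S \<in> Pow D"
      then obtain h where "h \<in> H" "h \<inter> C = S" using shatters_imp_trace[OF assms(1), of S] assms(2) by auto
      then have "h \<inter> D = S" using \<open>S \<in> Pow D\<close> assms(2) by auto
      then show "S \<in> trace_on H D" using \<open>h \<in> H\<close> by (auto simp: trace_on_def)
    qed
  qed (auto simp: trace_on_def)
  then show ?thesis using fin by (simp add: shatters_def card_Pow)
qed

lemma two_power_card_shattered_le:
  assumes sh: "shatters (B_per d) C" and L: "4 * d * (card C + 1) \<le> 2 ^ L"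
  shows "2 ^ card C \<le> 2 * ((card C + 1) * L) ^ d"
proof -
  define \<D> where "\<D> i = initial_segments (torus_coord \<circ> (\<lambda>c. c i)) C" for i :: nat
  have fin: "finite C" using sh by (simp add: shatters_def)
  have sub: "\<D> i \<subseteq> Pow C" and top: "C \<in> \<D> i" for i
    by (auto simp: \<D>_def initial_segments_def)
  show ?thesis
  proof (rule two_power_card_le[OF fin _ _ _ L, where \<F> = "\<lambda>i. arcs C (\<D> i)"])
    show "arcs C (\<D> i) \<subseteq> Pow C" for i by (rule arcs_subset[OF sub])
    show "card {G \<in> arcs C (\<D> i). card G = l} \<le> card C + 1" for i l
      by (rule card_arcs_of_size_le[OF fin sub top]) (simp add: \<D>_def initial_segments_chain)
    fix S assume "S \<subseteq> C"
    obtain a b where ab: "\<forall>i<d. a i \<in> {0..1} \<and> b i \<in> {0..1} \<and> a i \<noteq> b i"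
      and S: "Pi\<^sub>E {..<d} (\<lambda>i. torus_interval (a i) (b i)) \<inter> C = S"
      using shatters_imp_trace[OF sh \<open>S \<subseteq> C\<close>] by (auto simp: B_per_def)
    \<comment> \<open>Some box contains all of \<open>C\<close>. Extensionality then makes a point
      of \<open>C\<close> lie in a box as soon as every coordinate condition holds.\<close>
    have C: "C \<subseteq> extensional {..<d}"
      using shatters_imp_trace[OF sh order_refl] by (auto simp: B_per_def PiE_def)
    define G where "G i = {c \<in> C. c i \<notin> torus_interval (a i) (b i)}" for i
    have "G i \<in> arcs C (\<D> i)" if "i < d" for i
      unfolding G_def \<D>_def using torus_interval_compl_in_arcs[of "a i" "b i" C "\<lambda>c. c i"] ab that by auto
    moreover have "S = C - (\<Union>i<d. G i)"
      unfolding S[symmetric] using C by (auto simp: G_def PiE_def Pi_def)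
    ultimately show "\<exists>G. (\<forall>i<d. G i \<in> arcs C (\<D> i)) \<and> S = C - (\<Union>i<d. G i)" by blast
  qed
qed

text \<open>Take logarithms with \<open>L\<close> the ceiling of
  \<open>log 2 (4 * d * (n + 1))\<close>, which costs at most 1. The bound is implicit:
  \<open>card C\<close> occurs on both sides.\<close>

lemma card_shattered_le:
  assumes sh: "shatters (B_per d) C" and d: "d > 0"
  shows "real (card C) \<le>
    1 + d * log 2 ((card C + 1) * (log 2 (4 * d * (card C + 1)) + 1))"
proof -
  define n where "n = card C"
  define z where "z = log 2 (4 * d * (n + 1))"
  define L where "L = nat \<lceil>z\<rceil>"
  have "1 * 1 \<le> d * (n + 1)" using d by (intro mult_mono) auto
  then have "4 \<le> 4 * d * (n + 1)" by simp
  then have four: "4 \<le> real (4 * d * (n + 1))" by linarith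
  have "log 2 (2 ^ 2) \<le> z" unfolding z_def using four by (intro log_mono) auto
  then have z: "2 \<le> z" by (subst (asm) log_nat_power) auto
  then have L: "z \<le> L" "L \<le> z + 1" "0 < L" unfolding L_def by linarith+
  have "real (4 * d * (n + 1)) = 2 powr z" unfolding z_def using four by simp
  also have "\<dots> \<le> 2 powr L" using L by simp
  finally have "4 * d * (n + 1) \<le> 2 ^ L"
    by (simp add: powr_realpow flip: of_nat_le_iff[where 'a = real])
  then have "2 ^ n \<le> 2 * ((n + 1) * L) ^ d"
    using two_power_card_shattered_le[OF sh] by (simp add: n_def)
  then have "real (2 ^ n) \<le> real (2 * ((n + 1) * L) ^ d)" by (rule of_nat_mono)
  then have "log 2 (2 ^ n) \<le> log 2 (2 * real ((n + 1) * L) ^ d)"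
    by (intro log_mono) auto
  also have "\<dots> = 1 + d * log 2 (real ((n + 1) * L))"
  proof -
    have "0 < real ((n + 1) * L)" using L by (simp only: of_nat_0_less_iff) simp
    then show ?thesis by (simp only: log_mult_pos log_nat_power zero_less_power) simp
  qed
  also have "\<dots> \<le> 1 + d * log 2 ((n + 1) * (z + 1))"
  proof -
    have "real ((n + 1) * L) \<le> (n + 1) * (z + 1)"
      unfolding of_nat_mult using L by (intro mult_left_mono) auto
    moreover have "0 < real ((n + 1) * L)" using L by (simp only: of_nat_0_less_iff) simp
    ultimately show ?thesis by (intro add_left_mono mult_left_mono log_mono) auto
  qed
  finally show ?thesis by (simp add: n_def z_def log_nat_power)
qed

theorem theorem3p2:
  "\<forall>\<^sub>F d in sequentially.
     ereal_of_enat (VC (B_per d)) \<le>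
       ereal (real d * (log 2 (real d) + 3 * log 2 (log 2 (real d))))"
proof -
  define X where "X d = real d * (log 2 (real d) + 3 * log 2 (log 2 (real d)))" for d
  have "\<forall>\<^sub>F d in sequentially. 0 < d"
    by (rule eventually_gt_at_top)
  moreover have "\<forall>\<^sub>F d in sequentially. 0 \<le> X d"
    unfolding X_def by real_asymp
  \<comment> \<open>Here \<open>log 2 (X d + 2)\<close> is
    \<open>log 2 d + log 2 (log 2 d) + o(1)\<close>, and the logarithm of the other factor is
    \<open>log 2 (log 2 d) + 1 + o(1)\<close>. The third iterated logarithm in \<open>X d\<close>
    absorbs the constants.\<close>
  moreover have "\<forall>\<^sub>F d in sequentially.
      1 + real d * log 2 ((X d + 2) * (log 2 (4 * real d * (X d + 2)) + 1)) \<le> X d"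
    unfolding X_def by real_asymp
  ultimately have "\<forall>\<^sub>F d in sequentially. ereal_of_enat (VC (B_per d)) \<le> ereal (X d)"
  proof eventually_elim
    case (elim d)
    have "card C \<le> nat \<lfloor>X d\<rfloor>" if C: "shatters (B_per d) C" for C
    proof (rule ccontr)
      assume "\<not> ?thesis"
      then have "nat \<lfloor>X d\<rfloor> + 1 \<le> card C" by simp
      \<comment> \<open>The size is the least integer above \<open>X d\<close>: it violates the
        claimed bound, yet \<open>card D + 1\<close> is at most \<open>X d + 2\<close>, so the
        implicit inequality can be compared with the asymptotic one.\<close>
      then obtain D where D: "D \<subseteq> C" "card D = nat \<lfloor>X d\<rfloor> + 1"
        by (meson obtain_subset_with_card_n)
      define m where "m = real (card D + 1)"
      have m: "X d < card D" "2 \<le> m" "m \<le> X d + 2"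
        using D(2) elim(2) unfolding m_def by linarith+
      have "1 * 1 \<le> 4 * real d * m" using elim(1) m by (intro mult_mono) auto
      then have "1 \<le> 4 * real d * m" by simp
      then have pos: "0 \<le> log 2 (4 * real d * m)" "0 < 4 * real d * m"
        using zero_le_log_cancel_iff[of 2 "4 * real d * m"] by linarith+
      have "4 * real d * m \<le> 4 * real d * (X d + 2)" using m by (intro mult_left_mono) auto
      then have log: "log 2 (4 * real d * m) \<le> log 2 (4 * real d * (X d + 2))"
        using pos by (intro log_mono) auto
      have "real (card D) \<le> 1 + d * log 2 (m * (log 2 (4 * real d * m) + 1))"
        using card_shattered_le[OF shatters_subset[OF C D(1)] elim(1)] by (simp add: m_def algebra_simps)
      also have "\<dots> \<le> 1 + d * log 2 ((X d + 2) * (log 2 (4 * real d * (X d + 2)) + 1))"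
      proof -
        have "m * (log 2 (4 * real d * m) + 1) \<le> (X d + 2) * (log 2 (4 * real d * (X d + 2)) + 1)"
          using m log pos by (intro mult_mono) auto
        moreover have "0 < m * (log 2 (4 * real d * m) + 1)"
          using m(2) pos(1) by (intro mult_pos_pos) linarith+
        ultimately show ?thesis by (intro add_left_mono mult_left_mono log_mono) auto
      qed
      finally show False using elim(3) m(1) by simp
    qed
    then have "VC (B_per d) \<le> enat (nat \<lfloor>X d\<rfloor>)"
      unfolding VC_def by (intro SUP_least) auto
    then have "ereal_of_enat (VC (B_per d)) \<le> ereal_of_enat (enat (nat \<lfloor>X d\<rfloor>))"
      by (simp only: ereal_of_enat_le_iff)
    also have "\<dots> \<le> ereal (X d)" using elim(2) by simp
    finally show ?case .
  qed
  then show ?thesis by (simp add: X_def)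
qed

end
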